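(* $$\lim_{b\to\infty}\mathcal{KL}^{\mathrm{III}}_b=\mathcal{K},$$ where $b$ ranges over the integers $b\ge 2$, $\mathcal{KL}^{\mathrm{III}}_b$ is the type III base $b$ logarithmic Khinchine constant, and $\mathcal{K}$ is Khinchine's constant for simple continued fractions.
   Context: For each integer $b\ge 2$, the type III logarithmic Khinchine constant is $\mathcal{KL}^{\mathrm{III}}_b=b^{\mathcal{A}_b}$, where $$\mathcal{A}_b=\frac{1}{\log b\,\log\frac{b+1}{2b}}\sum_{\ell=2}^b\log\left(1-\frac1\ell\right)\log\left(1+\frac1\ell\right).$$ Khinchine's constant is $$\mathcal{K}=\prod_{r=1}^\infty\left(1+\frac{1}{r(r+2)}\right)^{\log_2 r}\approx 2.685452.$$ *)

theory Defs
  imports "HOL-Analysis.Analysis"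
begin

text \<open>
  The constants below are meant for bases \<open>b \<ge> 2\<close>; smaller values of \<open>b\<close> carry no meaning.
\<close>

definition KL3_exponent :: "nat \<Rightarrow> real" where
  "KL3_exponent b =
     1 / (ln (real b) * ln ((real b + 1) / (2 * real b))) *
     (\<Sum>l = 2..b. ln (1 - 1 / real l) * ln (1 + 1 / real l))"

definition KL3 :: "nat \<Rightarrow> real" where
  "KL3 b = real b powr KL3_exponent b"

text \<open>
  The library's infinite products are indexed from 0, so the factor with index \<open>n\<close> is the one
  for \<open>r = n + 1\<close>.
\<close>

definition khinchine_constant :: real where
  "khinchine_constant =
     (\<Prod>n. let r = real (Suc n) in (1 + 1 / (r * (r + 2))) powr log 2 r)"

end

theory Submission
  imports Defs "HOL-Real_Asymp.Real_Asymp"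
begin

text \<open>
  Write \<open>D r = ln (1 + 1/r)\<close>. The logarithm of the Khinchine factor with index \<open>r\<close> is
  \<open>log 2 r * (D r - D (r + 1))\<close>, and \<open>D (r - 1) = ln r - ln (r - 1) = - ln (1 - 1/r)\<close>.
  Summation by parts therefore turns the Khinchine series into \<open>- 1 / ln 2\<close> times the series
  of \<open>ln (1 - 1/l) * ln (1 + 1/l)\<close>, up to the vanishing boundary term
  \<open>ln N * D (N + 1)\<close>; and the factor \<open>ln b\<close> in the exponent of \<open>KL3 b\<close> cancels.
\<close>

text \<open>In the notation above, \<open>ln_step n\<close> is \<open>D (n + 1)\<close>; the shift
  matches the product indexed from 0.\<close>

definition ln_step :: "nat \<Rightarrow> real" where
  "ln_step n = ln (1 + 1 / real (Suc n))"

lemma ln_step_eq_diff: "ln_step n = ln (real n + 2) - ln (real n + 1)"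
proof -
  have "1 + 1 / real (Suc n) = (real n + 2) / (real n + 1)"
    by (simp add: field_simps)
  thus ?thesis unfolding ln_step_def by (simp add: ln_div)
qed

lemma ln_step_nonneg: "0 \<le> ln_step n"
  by (simp add: ln_step_def)

lemma ln_step_le: "ln_step n \<le> 1 / real (Suc n)"
  unfolding ln_step_def by (rule ln_add_one_self_le_self) simp

lemma summable_ln_step_mult: "summable (\<lambda>n. ln_step n * ln_step (Suc n))"
proof (rule summable_comparison_test')
  show "summable (\<lambda>n. inverse (real (Suc n) ^ 2))"
    using inverse_power_summable[of 2, where ?'a = real] by (subst summable_Suc_iff) simp
  fix n :: nat
  have "ln_step (Suc n) \<le> 1 / real (Suc n)"
    by (rule order_trans[OF ln_step_le]) (simp add: field_simps)
  hence "ln_step n * ln_step (Suc n) \<le> 1 / real (Suc n) * (1 / real (Suc n))"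
    by (intro mult_mono ln_step_le ln_step_nonneg) auto
  thus "norm (ln_step n * ln_step (Suc n)) \<le> inverse (real (Suc n) ^ 2)"
    by (simp add: ln_step_nonneg power2_eq_square inverse_eq_divide)
qed

text \<open>Substitute \<open>l = k + 2\<close>: the first factor becomes
  \<open>- ln_step k\<close>, the second \<open>ln_step (Suc k)\<close>.\<close>

lemma sum_ln_mult_ln_eq:
  "(\<Sum>l = 2..Suc n. ln (1 - 1 / real l) * ln (1 + 1 / real l)) =
   - (\<Sum>k<n. ln_step k * ln_step (Suc k))"
proof (induction n)
  case (Suc n)
  have "ln (1 - 1 / real (Suc (Suc n))) = - ln_step n"
  proof -
    have "1 - 1 / real (Suc (Suc n)) = (real n + 1) / (real n + 2)"
      by (simp add: field_simps)
    thus ?thesis by (simp add: ln_step_eq_diff ln_div)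
  qed
  thus ?case using Suc by (simp add: ln_step_def)
qed simp

text \<open>With \<open>r = n + 1\<close>, the argument is \<open>(r + 1)^2 / (r * (r + 2))\<close>,
  the quotient of \<open>1 + 1/r\<close> by \<open>1 + 1/(r + 1)\<close>.\<close>

lemma ln_khinchine_factor:
  "ln (1 + 1 / (real (Suc n) * (real (Suc n) + 2))) = ln_step n - ln_step (Suc n)"
proof -
  have "1 + 1 / (real (Suc n) * (real (Suc n) + 2)) =
      (real n + 2) * (real n + 2) / ((real n + 1) * (real n + 3))"
  proof -
    \<comment> \<open>This is \<open>(n + 1) * (n + 3)\<close> expanded, the denominator to be
      cleared.\<close>
    have "real n * real n + real n * 4 + 3 > 0"
      by (intro add_nonneg_pos add_nonneg_nonneg) auto
    thus ?thesis by (simp add: field_simps)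
  qed
  thus ?thesis
    by (simp add: ln_step_eq_diff ln_div ln_mult add.commute)
qed

text \<open>Abel summation: \<open>ln (n + 1)\<close> has increments \<open>ln_step n\<close>. The
  sum on the left has one more term, but its first is 0 because \<open>ln 1 = 0\<close>.\<close>

lemma sum_ln_mult_diff_ln_step:
  "(\<Sum>n<Suc N. ln (real (Suc n)) * (ln_step n - ln_step (Suc n))) =
   (\<Sum>n<N. ln_step n * ln_step (Suc n)) - ln (real N + 1) * ln_step (Suc N)"
proof (induction N)
  case (Suc N)
  have "ln (real N + 2) = ln_step N + ln (real N + 1)"
    by (simp add: ln_step_eq_diff)
  hence "ln (real (Suc (Suc N))) = ln_step N + ln (real N + 1)"
    by (simp add: add_ac)
  thus ?case
    using Suc by (simp add: algebra_simps)
qed simp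

lemma sums_ln_khinchine:
  "(\<lambda>n. ln (real (Suc n)) * (ln_step n - ln_step (Suc n))) sums
   (\<Sum>n. ln_step n * ln_step (Suc n))"
proof -
  \<comment> \<open>The boundary term decays like \<open>ln N / N\<close>.\<close>
  have "(\<lambda>N. ln (real N + 1) * ln_step (Suc N)) \<longlonglongrightarrow> 0"
    unfolding ln_step_def by real_asymp
  from tendsto_diff[OF summable_LIMSEQ[OF summable_ln_step_mult] this]
  show ?thesis
    unfolding sums_def by (subst filterlim_sequentially_Suc[symmetric])
      (simp only: sum_ln_mult_diff_ln_step diff_zero)
qed

lemma khinchine_constant_eq:
  "khinchine_constant = exp ((\<Sum>n. ln_step n * ln_step (Suc n)) / ln 2)"
proof -
  define g where "g n = ln (real (Suc n)) * (ln_step n - ln_step (Suc n)) / ln 2" for n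
  have "(let r = real (Suc n) in (1 + 1 / (r * (r + 2))) powr log 2 r) = exp (g n)" for n
  proof -
    \<comment> \<open>Excludes the base 0, where \<open>powr\<close> is 0 by convention.\<close>
    have "1 + 1 / (real (Suc n) * (real (Suc n) + 2)) > 0"
      by (intro add_pos_pos) auto
    thus ?thesis
      unfolding Let_def powr_def g_def ln_khinchine_factor log_def by simp
  qed
  hence "khinchine_constant = (\<Prod>n. exp (g n))"
    unfolding khinchine_constant_def by simp
  also have "g sums ((\<Sum>n. ln_step n * ln_step (Suc n)) / ln 2)"
    unfolding g_def by (intro sums_divide sums_ln_khinchine)
  hence "(\<Prod>n. exp (g n)) = exp ((\<Sum>n. ln_step n * ln_step (Suc n)) / ln 2)"
    by (metis prodinf_exp sums_iff)
  finally show ?thesis .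
qed

text \<open>For \<open>n \<ge> 1\<close>, \<open>ln (Suc n)\<close> is nonzero and cancels against
  the \<open>1 / ln b\<close> in the exponent.\<close>

lemma KL3_Suc_eq:
  assumes "n \<ge> 1"
  shows "KL3 (Suc n) =
    exp (- (\<Sum>k<n. ln_step k * ln_step (Suc k)) / ln ((real n + 2) / (2 * (real n + 1))))"
  using assms unfolding KL3_def KL3_exponent_def sum_ln_mult_ln_eq powr_def
  by (simp add: add_ac)

theorem theorem25:
  shows "KL3 \<longlonglongrightarrow> khinchine_constant"
proof -
  \<comment> \<open>The limit is \<open>- ln 2\<close>, whose sign cancels the minus in front of the
    sum.\<close>
  have "(\<lambda>n. ln ((real n + 2) / (2 * (real n + 1)))) \<longlonglongrightarrow> ln (1 / 2)"
    by real_asymp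
  hence "(\<lambda>n. exp (- (\<Sum>k<n. ln_step k * ln_step (Suc k)) /
            ln ((real n + 2) / (2 * (real n + 1))))) \<longlonglongrightarrow>
        exp (- (\<Sum>k. ln_step k * ln_step (Suc k)) / ln (1 / 2))"
    by (intro tendsto_exp tendsto_divide tendsto_minus summable_LIMSEQ summable_ln_step_mult) auto
  hence "(\<lambda>n. exp (- (\<Sum>k<n. ln_step k * ln_step (Suc k)) /
            ln ((real n + 2) / (2 * (real n + 1))))) \<longlonglongrightarrow> khinchine_constant"
    by (simp add: khinchine_constant_eq ln_div)
  moreover have "eventually (\<lambda>n. exp (- (\<Sum>k<n. ln_step k * ln_step (Suc k)) /
            ln ((real n + 2) / (2 * (real n + 1)))) = KL3 (Suc n)) sequentially"
    using eventually_ge_at_top[of 1] by eventually_elim (simp only: KL3_Suc_eq)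
  ultimately have "(\<lambda>n. KL3 (Suc n)) \<longlonglongrightarrow> khinchine_constant"
    by (rule Lim_transform_eventually)
  thus ?thesis by (simp only: filterlim_sequentially_Suc)
qed

end
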